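(* Let $n,m,L,N\in\mathbb{N}$ and consider the LTV system $x(k+1)=A(k)x(k)+B(k)u(k)$ with $A(k)\in\mathbb{R}^{n\times n}$, $B(k)\in\mathbb{R}^{n\times m}$. Let $X(k)\in\mathbb{R}^{n\times L}$, $k=0,\dots,N$, and $U(k)\in\mathbb{R}^{m\times L}$, $k=0,\dots,N-1$, be the data matrices formed from an ensemble of $L$ input-state data sequences of this system (see context), and suppose that $$\mathrm{rank}\begin{bmatrix}X(k)\\ U(k)\end{bmatrix}=n+m,\qquad k=0,\dots,N-1.$$ Let $Q_f=Q_f^\top\succeq0$, $Q(k)=Q(k)^\top\succeq0$ and $R(k)=R(k)^\top\succ0$, $k=0,\dots,N-1$. Then the optimal state feedback gain sequence $\{K^*(0),\dots,K^*(N-1)\}$ solving the finite-horizon LQR problem (see context) with $u^*(k)=K^*(k)x(k)$ is given by $$K^*(k)=U(k)H^*(k)S^*(k)^{-1},\qquad k=0,\dots,N-1,$$ where $H^*(k)$ and $S^*(k)$ are the solution of the semidefinite programme $$\min_{\mathcal S,\mathcal H,\mathcal O}\ \mathrm{Tr}\big(Q_fS(N)\big)+\sum_{k=0}^{N-1}\Big(\mathrm{Tr}\big(Q(k)S(k)\big)+\mathrm{Tr}\big(O(k)\big)\Big)$$ subject to $S(0)\succeq I_n$ and, for $k=0,\dots,N-1$, $$\begin{bmatrix}S(k+1)-I_n & X(k+1)H(k)\\ H(k)^\top X(k+1)^\top & S(k)\end{bmatrix}\succeq0,$$ $$\begin{bmatrix}O(k) & R(k)^{1/2}U(k)H(k)\\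 H(k)^\top U(k)^\top R(k)^{1/2} & S(k)\end{bmatrix}\succeq0,$$ $$S(k)=X(k)H(k),$$ with decision variables $\mathcal S=\{S(0),S(1),\dots,S(N)\}$, $\mathcal H=\{H(0),\dots,H(N-1)\}$, $\mathcal O=\{O(0),\dots,O(N-1)\}$, where $S(k)\in\mathbb{R}^{n\times n}$ and $O(k)\in\mathbb{R}^{m\times m}$ are symmetric and $H(k)\in\mathbb{R}^{L\times n}$.
   Context: $\mathrm{Tr}$ denotes the trace; $M\succ0$ ($M\succeq0$) means that the symmetric matrix $M$ is positive definite (semidefinite). Finite-horizon LQR problem: for the system $x(k+1)=A(k)x(k)+B(k)u(k)$ with initial condition $x(0)=x_0$, find the control sequence $\{u^*(0),\dots,u^*(N-1)\}$, as a function of the state, which minimises $$J(x(0),u(\cdot))=x(N)^\top Q_fx(N)+\sum_{k=0}^{N-1}\big(x(k)^\top Q(k)x(k)+u(k)^\top R(k)u(k)\big).$$ Data: for $j=1,\dots,L$, $u_{d,j}(k)\in\mathbb{R}^m$ ($k=0,\dots,N-1$) and $x_{d,j}(k)\in\mathbb{R}^n$ ($k=0,\dots,N$) are the input and state recorded in the $j$-th experiment. All $L$ experiments capture the same time-varying behaviour, i.e. $x_{d,j}(k+1)=A(k)x_{d,j}(k)+B(k)u_{d,j}(k)$ for all $j$ and $k=0,\dots,N-1$, with the same $A(k),B(k)$. The data matrices are $X(k)=[x_{d,1}(k),\dots,x_{d,L}(k)]$ and $U(k)=[u_{d,1}(k),\dots,u_{d,L}(k)]$; hence $X(k+1)=A(k)X(k)+B(k)U(k)$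 for $k=0,\dots,N-1$. *)

theory Defs
  imports "HOL-Analysis.Analysis"
begin

definition psd :: "real^'a^'a \<Rightarrow> bool" where
  "psd M \<longleftrightarrow> transpose M = M \<and> (\<forall>v. 0 \<le> v \<bullet> (M *v v))"

definition pd :: "real^'a^'a \<Rightarrow> bool" where
  "pd M \<longleftrightarrow> transpose M = M \<and> (\<forall>v. v \<noteq> 0 \<longrightarrow> 0 < v \<bullet> (M *v v))"

(* The principal square root; used only for positive definite M, where it exists and is unique. *)
definition psd_sqrt :: "real^'a^'a \<Rightarrow> real^'a^'a" where
  "psd_sqrt M = (THE T. psd T \<and> T ** T = M)"

definition vstack :: "'e^'l^'a \<Rightarrow> 'e^'l^'b \<Rightarrow> 'e^'l^('a + 'b)" where
  "vstack M1 M2 = (\<chi> i. case i of Inl a \<Rightarrow> M1 $ a | Inr b \<Rightarrow> M2 $ b)"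

definition hstack :: "'e^'a^'r \<Rightarrow> 'e^'b^'r \<Rightarrow> 'e^('a + 'b)^'r" where
  "hstack M1 M2 = (\<chi> i j. case j of Inl a \<Rightarrow> M1 $ i $ a | Inr b \<Rightarrow> M2 $ i $ b)"

definition block2 ::
  "'e^'a^'c \<Rightarrow> 'e^'b^'c \<Rightarrow> 'e^'a^'d \<Rightarrow> 'e^'b^'d \<Rightarrow> 'e^('a + 'b)^('c + 'd)" where
  "block2 M11 M12 M21 M22 = vstack (hstack M11 M12) (hstack M21 M22)"

primrec ltv_state ::
  "(nat \<Rightarrow> real^'n^'n) \<Rightarrow> (nat \<Rightarrow> real^'m^'n) \<Rightarrow> real^'n \<Rightarrow> (nat \<Rightarrow> real^'m) \<Rightarrow> nat \<Rightarrow> real^'n" where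
  "ltv_state A B x0 u 0 = x0"
| "ltv_state A B x0 u (Suc k) = A k *v ltv_state A B x0 u k + B k *v u k"

definition lqr_cost ::
  "(nat \<Rightarrow> real^'n^'n) \<Rightarrow> (nat \<Rightarrow> real^'m^'n) \<Rightarrow> nat \<Rightarrow> (nat \<Rightarrow> real^'n^'n) \<Rightarrow> (nat \<Rightarrow> real^'m^'m) \<Rightarrow>
    real^'n^'n \<Rightarrow> real^'n \<Rightarrow> (nat \<Rightarrow> real^'m) \<Rightarrow> real" where
  "lqr_cost A B N Q R Qf x0 u =
     (let x = ltv_state A B x0 u in
       x N \<bullet> (Qf *v x N) + (\<Sum>k<N. x k \<bullet> (Q k *v x k) + u k \<bullet> (R k *v u k)))"

(* Inputs are total sequences, but only their values at times below N affect the cost. *)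
definition lqr_optimal_input ::
  "(nat \<Rightarrow> real^'n^'n) \<Rightarrow> (nat \<Rightarrow> real^'m^'n) \<Rightarrow> nat \<Rightarrow> (nat \<Rightarrow> real^'n^'n) \<Rightarrow> (nat \<Rightarrow> real^'m^'m) \<Rightarrow>
    real^'n^'n \<Rightarrow> real^'n \<Rightarrow> (nat \<Rightarrow> real^'m) \<Rightarrow> bool" where
  "lqr_optimal_input A B N Q R Qf x0 u \<longleftrightarrow>
     (\<forall>v. lqr_cost A B N Q R Qf x0 u \<le> lqr_cost A B N Q R Qf x0 v)"

(* The gains do not depend on the initial state, and from every initial state the feedback
   generates the optimal input: the minimisers of the cost over all input sequences are exactly
   the sequences satisfying u k = K k *v x k along their own trajectory for k < N. *)
definition lqr_optimal_gain ::
  "(nat \<Rightarrow> real^'n^'n) \<Rightarrow> (nat \<Rightarrow> real^'m^'n) \<Rightarrow> nat \<Rightarrow> (nat \<Rightarrow> real^'n^'n) \<Rightarrow> (nat \<Rightarrow> real^'m^'m) \<Rightarrow>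
    real^'n^'n \<Rightarrow> (nat \<Rightarrow> real^'n^'m) \<Rightarrow> bool" where
  "lqr_optimal_gain A B N Q R Qf K \<longleftrightarrow>
     (\<forall>x0 u. lqr_optimal_input A B N Q R Qf x0 u \<longleftrightarrow>
        (\<forall>k<N. u k = K k *v ltv_state A B x0 u k))"

(* The column indexed by j is the vector recorded at time k in experiment j. *)
definition data_matrix :: "('l \<Rightarrow> nat \<Rightarrow> real^'a) \<Rightarrow> nat \<Rightarrow> real^'l^'a" where
  "data_matrix d k = (\<chi> i j. d j k $ i)"

definition sdp_feasible ::
  "nat \<Rightarrow> (nat \<Rightarrow> real^'l^'n) \<Rightarrow> (nat \<Rightarrow> real^'l^'m) \<Rightarrow> (nat \<Rightarrow> real^'m^'m) \<Rightarrow>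
    (nat \<Rightarrow> real^'n^'n) \<Rightarrow> (nat \<Rightarrow> real^'n^'l) \<Rightarrow> (nat \<Rightarrow> real^'m^'m) \<Rightarrow> bool" where
  "sdp_feasible N X U R S H Om \<longleftrightarrow>
     (\<forall>k\<le>N. transpose (S k) = S k) \<and>
     (\<forall>k<N. transpose (Om k) = Om k) \<and>
     psd (S 0 - mat 1) \<and>
     (\<forall>k<N.
        psd (block2 (S (Suc k) - mat 1) (X (Suc k) ** H k)
                    (transpose (H k) ** transpose (X (Suc k))) (S k)) \<and>
        psd (block2 (Om k) (psd_sqrt (R k) ** U k ** H k)
                    (transpose (H k) ** transpose (U k) ** psd_sqrt (R k)) (S k)) \<and>
        S k = X k ** H k)"

definition sdp_objective ::
  "nat \<Rightarrow> (nat \<Rightarrow> real^'n^'n) \<Rightarrow> real^'n^'n \<Rightarrow> (nat \<Rightarrow> real^'n^'n) \<Rightarrow> (nat \<Rightarrow> real^'m^'m) \<Rightarrow> real" where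
  "sdp_objective N Q Qf S Om =
     trace (Qf ** S N) + (\<Sum>k<N. trace (Q k ** S k) + trace (Om k))"

definition sdp_solution ::
  "nat \<Rightarrow> (nat \<Rightarrow> real^'l^'n) \<Rightarrow> (nat \<Rightarrow> real^'l^'m) \<Rightarrow> (nat \<Rightarrow> real^'n^'n) \<Rightarrow> (nat \<Rightarrow> real^'m^'m) \<Rightarrow>
    real^'n^'n \<Rightarrow> (nat \<Rightarrow> real^'n^'n) \<Rightarrow> (nat \<Rightarrow> real^'n^'l) \<Rightarrow> (nat \<Rightarrow> real^'m^'m) \<Rightarrow> bool" where
  "sdp_solution N X U Q R Qf S H Om \<longleftrightarrow>
     sdp_feasible N X U R S H Om \<and>
     (\<forall>S' H' Om'. sdp_feasible N X U R S' H' Om' \<longrightarrow>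
        sdp_objective N Q Qf S Om \<le> sdp_objective N Q Qf S' Om')"

end

theory Submission
  imports Defs
begin

text \<open>
  Both halves of the theorem rest on one identity. Let \<open>P\<close> be the solution of the backward Riccati
  recursion with final value \<open>Qf\<close>, let \<open>K\<close> be the corresponding gains and
  \<open>W k = R k + B\<^sup>T P (k + 1) B\<close>. Completing the square gives, for every state \<open>x\<close> and input \<open>u\<close>
  at time \<open>k\<close>, that the stage cost plus the \<open>P (k + 1)\<close>-cost of the successor state is the
  \<open>P k\<close>-cost of \<open>x\<close> plus the \<open>W k\<close>-form of \<open>u - K k x\<close> (\<open>riccati_complete_square\<close>).

  Along a trajectory this telescopes (\<open>lqr_cost_eq\<close>): the cost is a constant plus a sum of positive
  definite penalties, so the optimal inputs are exactly those of the feedback \<open>K\<close>.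

  For the semidefinite programme, a feasible \<open>S k\<close> dominates the identity and hence is invertible,
  so \<open>F = U H S\<^sup>-\<^sup>1\<close> is defined at each time and the data identity yields
  \<open>X (k + 1) H = (A + B F) S\<close>. By Schur complements the constraints say that
  \<open>S (k + 1)\<close> dominates \<open>I + (A + B F) S (A + B F)\<^sup>T\<close> and that \<open>O\<close> dominates the second moment
  \<open>R\<^sup>1\<^sup>/\<^sup>2 F S F\<^sup>T R\<^sup>1\<^sup>/\<^sup>2\<close> (\<open>step_constraints_iff\<close>). Summing the completed square over the columns
  of a square root of \<open>S k\<close> gives its trace version (\<open>trace_complete_square\<close>), which telescopes to
  the bound that the objective is at least the sum of all \<open>trace (P k)\<close> plus the traces of
  \<open>W (F - K) S (F - K)\<^sup>T\<close> (\<open>sdp_objective_lower_bound\<close>). By the rank condition the choice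
  \<open>F = K\<close> with equality in all constraints is realised by some \<open>H\<close> and attains this bound
  (\<open>sdp_value_attained\<close>). Every solution therefore has zero penalty, which forces \<open>F = K\<close>.

  The square roots used here come from the spectral theorem for real symmetric matrices, obtained
  by maximising the Rayleigh quotient.
\<close>

section \<open>Eigenbases and square roots of symmetric matrices\<close>

text \<open>The rule would hide products with a transpose behind vector-matrix products, and all
  computations below move a transposed matrix across an inner product.\<close>

declare transpose_matrix_vector [simp del]

lemma matrix_add_rdistrib:
  fixes M :: "real^'n^'m"
  shows "(M + C) ** D = M ** D + C ** D"
  by (simp add: matrix_matrix_mult_def vec_eq_iff distrib_right sum.distrib)

lemma matrix_diff_ldistrib:
  fixes M :: "real^'n^'m"
  shows "M ** (C - D) = M ** C - M ** D"
  by (simp add: matrix_matrix_mult_def vec_eq_iff right_diff_distrib flip: sum_subtractf)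

lemma matrix_diff_rdistrib:
  fixes M :: "real^'n^'m"
  shows "(M - C) ** D = M ** D - C ** D"
  by (simp add: matrix_matrix_mult_def vec_eq_iff left_diff_distrib flip: sum_subtractf)

text \<open>Along the line \<open>v + t w\<close> the form is \<open>2 t (w \<bullet> f v) + t\<^sup>2 (w \<bullet> f w)\<close>, whose linear term
  has to vanish if the form is never negative.\<close>

lemma nonneg_form_null_vector:
  fixes f :: "'a::real_inner \<Rightarrow> 'a"
  assumes "subspace V" "linear f"
    and sym: "\<And>x y. x \<in> V \<Longrightarrow> y \<in> V \<Longrightarrow> x \<bullet> f y = f x \<bullet> y"
    and nonneg: "\<And>x. x \<in> V \<Longrightarrow> 0 \<le> x \<bullet> f x"
    and "v \<in> V" "v \<bullet> f v = 0" "w \<in> V"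
  shows "w \<bullet> f v = 0"
proof (rule ccontr)
  define c q where "c = w \<bullet> f v" and "q = w \<bullet> f w"
  assume "w \<bullet> f v \<noteq> 0"
  then have "c \<noteq> 0" by (simp add: c_def)
  have q: "0 \<le> q" using nonneg[OF \<open>w \<in> V\<close>] by (simp add: q_def)
  \<comment> \<open>The value \<open>t\<close> nearly minimises \<open>2 * t * c + t\<^sup>2 * q\<close>; the \<open>1\<close> guards against \<open>q = 0\<close>.\<close>
  define t where "t = - c / (1 + q)"
  have "0 \<le> (v + t *\<^sub>R w) \<bullet> f (v + t *\<^sub>R w)"
    using assms by (intro nonneg subspace_add subspace_scale) auto
  also have "\<dots> = v \<bullet> f v + t * (v \<bullet> f w) + t * (w \<bullet> f v) + t * t * (w \<bullet> f w)"
    using \<open>linear f\<close> by (simp add: linear_add linear_scale inner_add_left inner_add_right algebra_simps)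
  also have "v \<bullet> f w = w \<bullet> f v"
    using sym[OF \<open>v \<in> V\<close> \<open>w \<in> V\<close>] by (simp add: inner_commute)
  finally have "0 \<le> 2 * t * c + t * t * q"
    using \<open>v \<bullet> f v = 0\<close> by (simp add: c_def q_def)
  also have "\<dots> = - (c\<^sup>2 * (2 + q) / (1 + q)\<^sup>2)"
    using q by (simp add: t_def divide_simps power2_eq_square) (simp add: algebra_simps)
  also have "\<dots> < 0"
    using q \<open>c \<noteq> 0\<close> by simp
  finally show False by simp
qed

text \<open>On the compact unit sphere of \<open>V\<close> the Rayleigh quotient has a maximum, and every maximiser is
  an eigenvector.\<close>

lemma selfadjoint_has_eigenvector:
  fixes f :: "'a::euclidean_space \<Rightarrow> 'a"
  assumes V: "subspace V" "V \<noteq> {0}" "f ` V \<subseteq> V"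
    and f: "linear f" "\<And>x y. x \<bullet> f y = f x \<bullet> y"
  shows "\<exists>v\<in>V. norm v = 1 \<and> f v = (v \<bullet> f v) *\<^sub>R v"
proof -
  have comp: "compact (V \<inter> sphere 0 1)"
    by (intro closed_Int_compact closed_subspace V) auto
  obtain z where z: "z \<in> V" "z \<noteq> 0"
    using V(1,2) subspace_0 by blast
  have ne: "V \<inter> sphere 0 1 \<noteq> {}"
  proof -
    have "z /\<^sub>R norm z \<in> V \<inter> sphere 0 1"
      using z V(1) by (simp add: subspace_scale)
    then show ?thesis by blast
  qed
  have cont: "continuous_on (V \<inter> sphere 0 1) (\<lambda>x. x \<bullet> f x)"
    by (intro continuous_intros linear_continuous_on linear_conv_bounded_linear[THEN iffD1] f)
  obtain v where v: "v \<in> V" "norm v = 1"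
    and max: "\<And>x. x \<in> V \<Longrightarrow> norm x = 1 \<Longrightarrow> x \<bullet> f x \<le> v \<bullet> f v"
    using continuous_attains_sup[OF comp ne cont] by auto
  define l where "l = v \<bullet> f v"
  \<comment> \<open>At a maximum of the Rayleigh quotient, the form of \<open>g\<close> is nonnegative and vanishes.\<close>
  define g where "g x = l *\<^sub>R x - f x" for x
  have g_lin: "linear g"
    unfolding g_def by (intro linear_compose_sub linear_scale_self f)
  have g_V: "g x \<in> V" if "x \<in> V" for x
    using that V by (auto simp: g_def intro!: subspace_diff subspace_scale)
  have g_nonneg: "0 \<le> x \<bullet> g x" if "x \<in> V" for x
  proof (cases "x = 0")
    case False
    have "(x /\<^sub>R norm x) \<bullet> f (x /\<^sub>R norm x) \<le> l"
      unfolding l_def using that False V by (intro max) (auto simp: subspace_scale)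
    then have "x \<bullet> f x / (norm x)\<^sup>2 \<le> l"
      using f(1) by (simp add: linear_scale power2_eq_square divide_simps)
    then have "x \<bullet> f x \<le> l * (norm x)\<^sup>2"
      using False by (simp add: divide_simps)
    then show ?thesis
      by (simp add: g_def inner_diff_right power2_norm_eq_inner)
  qed simp
  have "v \<bullet> v = 1" using v(2) by (simp add: norm_eq_1)
  then have gv: "v \<bullet> g v = 0"
    by (simp add: g_def inner_diff_right l_def)
  have "g v \<bullet> g v = 0"
  proof (rule nonneg_form_null_vector[OF V(1) g_lin _ g_nonneg v(1) gv g_V[OF v(1)]])
    show "x \<bullet> g y = g x \<bullet> y" for x y
      by (simp only: g_def inner_diff_left inner_diff_right f(2)) simp
  qed
  then have "f v = l *\<^sub>R v" by (simp add: g_def)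
  then show ?thesis using v l_def by auto
qed

text \<open>The spectral theorem, by splitting off one eigenvector at a time: its orthogonal complement
  in \<open>V\<close> is invariant again.\<close>

lemma selfadjoint_orthonormal_eigenbasis:
  fixes f :: "'a::euclidean_space \<Rightarrow> 'a"
  assumes f: "linear f" "\<And>x y. x \<bullet> f y = f x \<bullet> y"
    and V: "subspace V" "f ` V \<subseteq> V"
  shows "\<exists>E. pairwise orthogonal E \<and> span E = V \<and> (\<forall>e\<in>E. norm e = 1 \<and> f e = (e \<bullet> f e) *\<^sub>R e)"
  using V
proof (induction "dim V" arbitrary: V rule: less_induct)
  case less
  show ?case
  proof (cases "V = {0}")
    case True
    then show ?thesis by (intro exI[of _ "{}"]) auto
  next
    case False
    obtain v where v: "v \<in> V" "norm v = 1" "f v = (v \<bullet> f v) *\<^sub>R v"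
      using selfadjoint_has_eigenvector[OF less.prems(1) False less.prems(2) f] by blast
    have vv: "v \<bullet> v = 1" using v(2) by (simp add: norm_eq_1)
    define W where "W = V \<inter> {x. v \<bullet> x = 0}"
    have W: "subspace W"
      unfolding W_def by (intro subspace_inter less.prems subspace_hyperplane)
    have "v \<bullet> f x = 0" if "v \<bullet> x = 0" for x
      using that f(2)[of v x] v(3) by (metis inner_scaleR_left mult_zero_right)
    then have fW: "f ` W \<subseteq> W"
      using less.prems by (auto simp: W_def)
    have "v \<notin> W" using vv by (simp add: W_def)
    then have "W \<subset> V" using v(1) unfolding W_def by blast
    then have "dim W < dim V"
      using W less.prems(1) by (intro dim_psubset) (metis span_eq_iff)
    from less.hyps[OF this W fW] obtain E where E: "pairwise orthogonal E" "span E = W"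
      "\<forall>e\<in>E. norm e = 1 \<and> f e = (e \<bullet> f e) *\<^sub>R e" by blast
    have orth: "v \<bullet> e = 0" if "e \<in> E" for e
      using that E(2) span_base[of e E] by (auto simp: W_def)
    have "span (insert v E) = V"
    proof
      have "insert v E \<subseteq> V"
        using v(1) E(2) span_superset[of E] by (auto simp: W_def)
      then show "span (insert v E) \<subseteq> V"
        using less.prems(1) by (intro span_minimal)
    next
      show "V \<subseteq> span (insert v E)"
      proof
        fix x assume "x \<in> V"
        then have "x - (v \<bullet> x) *\<^sub>R v \<in> W"
          using v(1) vv less.prems(1)
          by (auto simp: W_def inner_diff_right intro!: subspace_diff subspace_scale)
        then show "x \<in> span (insert v E)"
          unfolding span_breakdown_eq using E(2) by blast
      qed
    qed
    moreover have "pairwise orthogonal (insert v E)"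
      using E(1) orth by (auto simp: pairwise_insert orthogonal_def inner_commute)
    ultimately show ?thesis using E(3) v by (intro exI[of _ "insert v E"]) auto
  qed
qed

lemma inner_transpose_left:
  fixes M :: "real^'n^'m"
  shows "(transpose M *v x) \<bullet> y = x \<bullet> (M *v y)"
  by (simp add: transpose_matrix_vector dot_lmul_matrix)

lemma inner_transpose_right:
  fixes M :: "real^'n^'m"
  shows "x \<bullet> (transpose M *v y) = (M *v x) \<bullet> y"
  by (metis inner_transpose_left inner_commute)

lemma symmetric_matrix_inner:
  fixes M :: "real^'n^'n"
  assumes "transpose M = M"
  shows "x \<bullet> (M *v y) = (M *v x) \<bullet> y"
  using inner_transpose_left[of M x y] by (simp only: assms)

text \<open>Rescaling each vector of an orthonormal eigenbasis by the root of its eigenvalue.\<close>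

lemma psd_sqrt_exists:
  fixes M :: "real^'n^'n"
  assumes "psd M"
  shows "\<exists>T. psd T \<and> T ** T = M"
proof -
  have sym: "transpose M = M" and nonneg: "\<And>v. 0 \<le> v \<bullet> (M *v v)"
    using assms by (auto simp: psd_def)
  obtain E where E: "pairwise orthogonal E" "span E = (UNIV :: (real^'n) set)"
    "\<And>e. e \<in> E \<Longrightarrow> norm e = 1" "\<And>e. e \<in> E \<Longrightarrow> M *v e = (e \<bullet> (M *v e)) *\<^sub>R e"
    using selfadjoint_orthonormal_eigenbasis[OF matrix_vector_mul_linear[of M]
        symmetric_matrix_inner[OF sym] subspace_UNIV] by auto
  have fin: "finite E"
    by (rule pairwise_orthogonal_imp_finite[OF E(1)])
  have expand: "(\<Sum>e\<in>E. (x \<bullet> e) *\<^sub>R e) = x" for x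
    using orthonormal_basis_expand[OF E(1) E(3) _ fin] E(2) by blast
  define l where "l e = e \<bullet> (M *v e)" for e
  define g where "g x = (\<Sum>e\<in>E. (sqrt (l e) * (x \<bullet> e)) *\<^sub>R e)" for x
  have g_lin: "linear g"
    unfolding g_def by (intro linearI)
      (simp_all add: inner_add_left scaleR_add_left sum.distrib distrib_left scaleR_sum_right mult.left_commute)
  have g_E: "g e = sqrt (l e) *\<^sub>R e" if "e \<in> E" for e
  proof -
    have "g e = (\<Sum>d\<in>E. if d = e then sqrt (l e) *\<^sub>R e else 0)"
      unfolding g_def using that E(1,3)
      by (intro sum.cong) (auto simp: pairwise_def orthogonal_def norm_eq_1)
    then show ?thesis using that fin by simp
  qed
  have g_g: "g (g x) = M *v x" for x
  proof -
    have "g (g x) = (\<Sum>e\<in>E. (sqrt (l e) * (x \<bullet> e)) *\<^sub>R g e)"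
      by (subst (2) g_def) (simp add: linear_sum[OF g_lin] linear_scale[OF g_lin])
    also have "\<dots> = (\<Sum>e\<in>E. (x \<bullet> e) *\<^sub>R (M *v e))"
    proof (rule sum.cong)
      fix e assume "e \<in> E"
      moreover have "sqrt (l e) * sqrt (l e) = l e"
        using nonneg by (simp add: l_def)
      ultimately show "(sqrt (l e) * (x \<bullet> e)) *\<^sub>R g e = (x \<bullet> e) *\<^sub>R (M *v e)"
        using E(4)[of e] g_E[of e] by (simp add: l_def[symmetric] mult.assoc mult.left_commute)
    qed simp
    also have "\<dots> = M *v (\<Sum>e\<in>E. (x \<bullet> e) *\<^sub>R e)"
      by (simp add: linear_sum[OF matrix_vector_mul_linear] linear_scale[OF matrix_vector_mul_linear])
    finally show ?thesis by (simp add: expand)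
  qed
  have g_sym: "x \<bullet> g y = g x \<bullet> y" for x y
    by (simp add: g_def inner_sum_left inner_sum_right inner_commute mult.commute mult.left_commute)
  have g_nonneg: "0 \<le> x \<bullet> g x" for x
    unfolding g_def inner_sum_right
    by (intro sum_nonneg) (simp add: l_def nonneg inner_commute mult.assoc)
  define T where "T = matrix g"
  have T: "T *v x = g x" for x
    unfolding T_def using g_lin by (simp add: matrix_works linear_matrix_vector_mul_eq)
  have "transpose T = T"
  proof -
    have "x \<bullet> (transpose T *v y) = x \<bullet> (T *v y)" for x y
      using g_sym[of x y] by (simp add: T inner_transpose_right)
    then have "transpose T *v y = T *v y" for y
      by (intro vector_eq_ldot[THEN iffD1]) simp
    then show ?thesis
      by (intro matrix_eq[THEN iffD2]) simp
  qed
  moreover have "T ** T = M"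
    unfolding matrix_eq by (simp add: matrix_vector_mul_assoc[symmetric] T g_g)
  ultimately show ?thesis
    using g_nonneg by (auto simp: psd_def T)
qed

lemma psd_null_vector:
  fixes M :: "real^'n^'n"
  assumes "psd M" "v \<bullet> (M *v v) = 0"
  shows "M *v v = 0"
proof -
  have "(M *v v) \<bullet> (M *v v) = 0"
  proof (rule nonneg_form_null_vector[where V = UNIV and f = "(*v) M" and v = v])
    show "x \<bullet> (M *v y) = (M *v x) \<bullet> y" for x y
      using assms by (intro symmetric_matrix_inner) (simp add: psd_def)
  qed (use assms in \<open>simp_all add: psd_def matrix_vector_mul_linear\<close>)
  then show ?thesis by simp
qed

lemma trace_congruence_columns:
  fixes M :: "real^'m^'m" and Y :: "real^'n^'m"
  shows "trace (transpose Y ** M ** Y) = (\<Sum>i\<in>UNIV. column i Y \<bullet> (M *v column i Y))"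
proof -
  have entry: "(C ** D) $ i $ i = C $ i \<bullet> column i D" for C :: "real^'m^'n" and D :: "real^'n^'m" and i
    by (simp add: matrix_matrix_mult_def inner_vec_def column_def)
  have "column i (M ** Y) = M *v column i Y" "transpose Y $ i = column i Y" for i
    by (simp_all add: vec_eq_iff column_def matrix_vector_mult_def matrix_matrix_mult_def transpose_def)
  then have "(transpose Y ** M ** Y) $ i $ i = column i Y \<bullet> (M *v column i Y)" for i
    unfolding matrix_mul_assoc[symmetric] entry by simp
  then show ?thesis by (simp add: trace_def)
qed

lemma pd_imp_psd: "pd M \<Longrightarrow> psd M"
  unfolding pd_def psd_def by (metis inner_zero_left less_eq_real_def)

text \<open>The constant \<^const>\<open>psd_sqrt\<close> is a definite description, so uniqueness is what gives access to
  its defining property. A trace computation replaces the usual argument with commuting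
  eigenspaces.\<close>

lemma psd_sqrt_unique:
  fixes M :: "real^'n^'n"
  assumes "pd M" "psd T" "T ** T = M" "psd T'" "T' ** T' = M"
  shows "T = T'"
proof -
  have sym: "transpose T = T" "transpose T' = T'" using assms by (auto simp: psd_def)
  have pos: "v = 0" if "psd Z" "Z ** Z = M" "v \<bullet> (Z *v v) = 0" for Z v
  proof -
    have "M *v v = 0"
      using psd_null_vector[OF that(1,3)] that(2) by (metis matrix_vector_mul_assoc matrix_vector_mult_0_right)
    then show ?thesis using \<open>pd M\<close> by (force simp: pd_def)
  qed
  define D where "D = T - T'"
  have D_sym: "transpose D = D"
    using sym by (simp add: D_def transpose_def vec_eq_iff)
  \<comment> \<open>As \<open>T ** D + D ** T' = 0\<close>, multiplying by \<open>D\<close> makes two nonnegative traces cancel.\<close>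
  have "trace (D ** T ** D) + trace (D ** T' ** D) = trace (D ** (T ** D)) + trace (D ** (D ** T'))"
    by (metis matrix_mul_assoc trace_mul_sym)
  also have "\<dots> = trace (D ** (T ** D + D ** T'))"
    by (simp add: matrix_add_ldistrib trace_add)
  also have "T ** D + D ** T' = 0"
    using assms(3,5) by (simp add: D_def matrix_diff_ldistrib matrix_diff_rdistrib)
  finally have "trace (transpose D ** T ** D) + trace (transpose D ** T' ** D) = 0"
    by (simp add: D_sym trace_def matrix_matrix_mult_def)
  then have "(\<Sum>i\<in>UNIV. column i D \<bullet> (T *v column i D)) + (\<Sum>i\<in>UNIV. column i D \<bullet> (T' *v column i D)) = 0"
    by (simp only: trace_congruence_columns)
  moreover have "0 \<le> (\<Sum>i\<in>UNIV. column i D \<bullet> (T *v column i D))" "0 \<le> (\<Sum>i\<in>UNIV. column i D \<bullet> (T' *v column i D))"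
    using assms by (auto simp: psd_def intro!: sum_nonneg)
  ultimately have "(\<Sum>i\<in>UNIV. column i D \<bullet> (T *v column i D)) = 0" by linarith
  then have "column i D \<bullet> (T *v column i D) = 0" for i
    using assms by (subst (asm) sum_nonneg_eq_0_iff) (auto simp: psd_def)
  then have "column i D = 0" for i
    using pos assms by blast
  then have "D = 0" by (simp add: column_def vec_eq_iff)
  then show ?thesis by (simp add: D_def)
qed

lemma psd_sqrt_pd:
  fixes M :: "real^'n^'n"
  assumes "pd M"
  shows "psd (psd_sqrt M)" "psd_sqrt M ** psd_sqrt M = M"
proof -
  obtain T where T: "psd T \<and> T ** T = M"
    using psd_sqrt_exists[OF pd_imp_psd[OF assms]] by blast
  have "psd (psd_sqrt M) \<and> psd_sqrt M ** psd_sqrt M = M"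
    unfolding psd_sqrt_def
    by (rule theI[where a = T]) (use T psd_sqrt_unique[OF assms] in blast)+
  then show "psd (psd_sqrt M)" "psd_sqrt M ** psd_sqrt M = M" by auto
qed

section \<open>Quadratic forms and traces\<close>

lemma matrix_vector_mult_minus:
  fixes M :: "real^'n^'m"
  shows "(- M) *v x = - (M *v x)"
  by (simp add: matrix_vector_mult_def vec_eq_iff sum_negf)

lemma transpose_add: "transpose (C + D) = transpose C + transpose (D :: real^'n^'m)"
  by (simp add: transpose_def vec_eq_iff)

lemma transpose_diff: "transpose (C - D) = transpose C - transpose (D :: real^'n^'m)"
  by (simp add: transpose_def vec_eq_iff)

lemma psd_mat_1: "psd (mat 1)"
  by (simp add: psd_def)

lemma psd_add: "psd M \<Longrightarrow> psd M' \<Longrightarrow> psd (M + M')"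
  by (simp add: psd_def transpose_add matrix_vector_mult_add_rdistrib inner_add_right)

lemma psd_congruence:
  fixes M :: "real^'m^'m" and G :: "real^'m^'n"
  assumes "psd M"
  shows "psd (G ** M ** transpose G)"
proof -
  have "v \<bullet> ((G ** M ** transpose G) *v v) = (transpose G *v v) \<bullet> (M *v (transpose G *v v))" for v
    by (simp add: inner_transpose_left matrix_vector_mul_assoc[symmetric])
  with assms show ?thesis
    by (simp add: psd_def matrix_transpose_mul matrix_mul_assoc)
qed

lemma psd_congruence_transpose: "psd M \<Longrightarrow> psd (transpose G ** M ** G)"
  using psd_congruence[of M "transpose G"] by simp

lemma pd_add_psd: "pd M \<Longrightarrow> psd M' \<Longrightarrow> pd (M + M')"
  by (simp add: psd_def pd_def transpose_add matrix_vector_mult_add_rdistrib inner_add_right add_pos_nonneg)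

lemma pd_mat_1: "pd (mat 1)"
  by (simp add: pd_def)

lemma pd_if_ge_mat_1: "psd (M - mat 1) \<Longrightarrow> pd M"
  using pd_add_psd[OF pd_mat_1, of "M - mat 1"] by simp

lemma pd_zero_iff: "pd M \<Longrightarrow> v \<bullet> (M *v v) = 0 \<longleftrightarrow> v = 0"
  unfolding pd_def by (metis inner_zero_left less_irrefl)

lemma pd_invertible:
  fixes M :: "real^'n^'n"
  assumes "pd M"
  shows "invertible M"
proof -
  have "x = 0" if "M *v x = 0" for x
    using pd_zero_iff[OF assms, of x] that by simp
  then show ?thesis
    using matrix_left_invertible_ker invertible_left_inverse by blast
qed

lemma matrix_inv_cancel:
  fixes M :: "real^'n^'n"
  assumes "invertible M"
  shows "M ** matrix_inv M = mat 1" "matrix_inv M ** M = mat 1"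
  using someI_ex[OF assms[unfolded invertible_def]] by (simp_all add: matrix_inv_def)

text \<open>Writing \<open>S = T T\<close> turns a trace into a sum of values of a quadratic form. This transfers
  identities about single states and inputs to identities about the matrices of the semidefinite
  programme.\<close>

lemma trace_congruence_sqrt:
  fixes F :: "real^'n^'m"
  assumes "transpose T = T" "T ** T = S"
  shows "trace (M ** (F ** S ** transpose F)) = (\<Sum>i\<in>UNIV. (F *v column i T) \<bullet> (M *v (F *v column i T)))"
proof -
  have "F ** S ** transpose F = (F ** T) ** transpose (F ** T)"
    using assms by (simp add: matrix_transpose_mul matrix_mul_assoc)
      (metis matrix_mul_assoc)
  then have "trace (M ** (F ** S ** transpose F)) = trace (transpose (F ** T) ** M ** (F ** T))"
    by (metis matrix_mul_assoc trace_mul_sym)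
  moreover have "column i (F ** T) = F *v column i T" for i
    by (simp add: vec_eq_iff column_def matrix_vector_mult_def matrix_matrix_mult_def)
  ultimately show ?thesis
    by (simp add: trace_congruence_columns)
qed

lemma trace_congruence_nonneg:
  fixes F :: "real^'n^'m"
  assumes "psd M" "psd S"
  shows "0 \<le> trace (M ** (F ** S ** transpose F))"
proof -
  obtain T where "transpose T = T" "T ** T = S"
    using psd_sqrt_exists[OF \<open>psd S\<close>] by (auto simp: psd_def)
  from trace_congruence_sqrt[OF this, of M F] \<open>psd M\<close> show ?thesis
    by (simp add: psd_def sum_nonneg)
qed

lemma trace_psd_mult_nonneg:
  assumes "psd M" "psd S"
  shows "0 \<le> trace (M ** S)"
  using trace_congruence_nonneg[OF assms, of "mat 1"] by simp

text \<open>The trace is a sum of values of the positive definite form of \<open>M\<close> at the columns of \<open>F T\<close>, where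
  \<open>S = T T\<close>; as \<open>S\<close> is invertible, these columns determine \<open>F\<close>.\<close>

lemma trace_congruence_eq_0:
  fixes F :: "real^'n^'m"
  assumes "pd M" "pd S" "trace (M ** (F ** S ** transpose F)) = 0"
  shows "F = 0"
proof -
  obtain T where T: "transpose T = T" "T ** T = S"
    using psd_sqrt_exists[OF pd_imp_psd[OF \<open>pd S\<close>]] by (auto simp: psd_def)
  have "(\<Sum>i\<in>UNIV. (F *v column i T) \<bullet> (M *v (F *v column i T))) = 0"
    using assms(3) trace_congruence_sqrt[OF T, of M F] by simp
  then have "(F *v column i T) \<bullet> (M *v (F *v column i T)) = 0" for i
    using pd_imp_psd[OF \<open>pd M\<close>] by (subst (asm) sum_nonneg_eq_0_iff) (auto simp: psd_def)
  then have col: "F *v column i T = 0" for i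
    using pd_zero_iff[OF \<open>pd M\<close>] by blast
  have "F ** T = 0"
    using col by (simp add: vec_eq_iff column_def matrix_vector_mult_def matrix_matrix_mult_def)
  then have "F ** S = 0"
    using T by (metis matrix_mul_assoc times0_left)
  then show ?thesis
    using matrix_inv_cancel(1)[OF pd_invertible[OF \<open>pd S\<close>]]
    by (metis matrix_mul_assoc times0_left matrix_mul_rid)
qed

lemma psd_sqrt_transpose: "pd M \<Longrightarrow> transpose (psd_sqrt M) = psd_sqrt M"
  using psd_sqrt_pd(1)[of M] by (simp add: psd_def)

text \<open>The cyclic property of the trace recombines the two square roots, so the input cost enters
  the programme through \<open>M\<close> itself.\<close>

lemma trace_sqrt_congruence:
  assumes "pd M"
  shows "trace (psd_sqrt M ** F ** S ** transpose (psd_sqrt M ** F)) = trace (M ** (F ** S ** transpose F))"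
proof -
  have "trace (psd_sqrt M ** F ** S ** transpose (psd_sqrt M ** F))
      = trace ((psd_sqrt M ** (F ** S ** transpose F)) ** psd_sqrt M)"
    by (simp add: matrix_transpose_mul psd_sqrt_transpose[OF assms] matrix_mul_assoc)
  also have "\<dots> = trace (psd_sqrt M ** psd_sqrt M ** (F ** S ** transpose F))"
    by (subst trace_mul_sym) (simp add: matrix_mul_assoc)
  finally show ?thesis
    by (simp add: psd_sqrt_pd(2)[OF assms])
qed

section \<open>Block matrices and Schur complements\<close>

definition vcat :: "'e^'a \<Rightarrow> 'e^'b \<Rightarrow> 'e^('a + 'b)" where
  "vcat x y = (\<chi> i. case i of Inl a \<Rightarrow> x $ a | Inr b \<Rightarrow> y $ b)"

lemma ex_vcat: "\<exists>x y. v = vcat x y"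
  by (rule exI[of _ "\<chi> a. v $ Inl a"], rule exI[of _ "\<chi> b. v $ Inr b"])
    (simp add: vcat_def vec_eq_iff split: sum.split)

lemma sum_UNIV_sum_type:
  fixes f :: "'a::finite + 'b::finite \<Rightarrow> 'c::comm_monoid_add"
  shows "sum f UNIV = (\<Sum>a\<in>UNIV. f (Inl a)) + (\<Sum>b\<in>UNIV. f (Inr b))"
proof -
  have "sum f UNIV = sum f (UNIV <+> UNIV)"
    by (simp only: UNIV_Plus_UNIV)
  also have "\<dots> = (\<Sum>a\<in>UNIV. f (Inl a)) + (\<Sum>b\<in>UNIV. f (Inr b))"
    by (subst sum.Plus) (simp_all add: o_def)
  finally show ?thesis .
qed

lemma inner_vcat:
  fixes x x' :: "real^'a" and y y' :: "real^'b"
  shows "vcat x y \<bullet> vcat x' y' = x \<bullet> x' + y \<bullet> y'"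
  by (simp add: inner_vec_def sum_UNIV_sum_type vcat_def)

lemma vcat_eq_iff: "vcat x y = vcat x' y' \<longleftrightarrow> x = x' \<and> y = y'"
proof
  assume eq: "vcat x y = vcat x' y'"
  have "x $ a = x' $ a" "y $ b = y' $ b" for a b
    using arg_cong[OF eq, of "\<lambda>v. v $ Inl a"] arg_cong[OF eq, of "\<lambda>v. v $ Inr b"]
    by (simp_all add: vcat_def)
  then show "x = x' \<and> y = y'" by (simp add: vec_eq_iff)
qed simp

lemma vstack_mult_vector: "vstack M1 M2 *v x = vcat (M1 *v x) (M2 *v x)"
  by (simp add: vstack_def vcat_def matrix_vector_mult_def vec_eq_iff split: sum.split)

lemma block2_mult_vcat:
  fixes M11 :: "real^'a^'c" and M12 :: "real^'b^'c" and M21 :: "real^'a^'d" and M22 :: "real^'b^'d"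
  shows "block2 M11 M12 M21 M22 *v vcat x y = vcat (M11 *v x + M12 *v y) (M21 *v x + M22 *v y)"
  by (simp add: block2_def hstack_def vstack_def vcat_def matrix_vector_mult_def vec_eq_iff
      sum_UNIV_sum_type split: sum.split)

lemma transpose_block2:
  "transpose (block2 M11 M12 M21 M22)
    = block2 (transpose M11) (transpose M21) (transpose M12) (transpose M22)"
  by (simp add: block2_def hstack_def vstack_def transpose_def vec_eq_iff split: sum.split)

text \<open>Since the off-diagonal block has the form \<open>G S\<close>, the block form equals the form of the
  Schur complement plus a square in the metric \<open>S\<close>, and \<open>y = - G\<^sup>T x\<close> makes that square vanish.\<close>

lemma psd_block2_iff_Schur:
  fixes M :: "real^'m^'m" and G :: "real^'n^'m"
  assumes M: "transpose M = M" and S: "psd S"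
  shows "psd (block2 M (G ** S) (transpose (G ** S)) S) \<longleftrightarrow> psd (M - G ** S ** transpose G)"
    (is "psd ?B \<longleftrightarrow> psd ?C")
proof -
  have S_sym: "transpose S = S" using S by (simp add: psd_def)
  have quad: "vcat x y \<bullet> (?B *v vcat x y)
      = x \<bullet> (?C *v x) + (transpose G *v x + y) \<bullet> (S *v (transpose G *v x + y))" for x y
  proof -
    have "y \<bullet> (transpose (G ** S) *v x) = x \<bullet> (G *v (S *v y))"
      by (simp add: inner_transpose_right matrix_vector_mul_assoc[symmetric] inner_commute)
    moreover have "y \<bullet> (S *v (transpose G *v x)) = x \<bullet> (G *v (S *v y))"
      by (simp add: symmetric_matrix_inner[OF S_sym] inner_transpose_right inner_commute)
    ultimately show ?thesis
      by (simp add: block2_mult_vcat inner_vcat matrix_vector_mult_diff_rdistrib inner_diff_right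
          matrix_vector_right_distrib inner_add_right inner_add_left inner_transpose_left
          matrix_vector_mul_assoc[symmetric])
  qed
  have "transpose ?B = ?B"
    by (simp add: transpose_block2 M S_sym)
  moreover have "transpose ?C = ?C"
    by (simp add: transpose_diff M S_sym matrix_transpose_mul matrix_mul_assoc)
  moreover have "(\<forall>v. 0 \<le> v \<bullet> (?B *v v)) \<longleftrightarrow> (\<forall>x. 0 \<le> x \<bullet> (?C *v x))"
  proof safe
    fix x assume "\<forall>v. 0 \<le> v \<bullet> (?B *v v)"
    \<comment> \<open>This choice of the lower component minimises the form of the block matrix.\<close>
    then have "0 \<le> vcat x (- (transpose G *v x)) \<bullet> (?B *v vcat x (- (transpose G *v x)))" by blast
    then show "0 \<le> x \<bullet> (?C *v x)" unfolding quad by simp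
  next
    fix v :: "real^('m + 'n)" assume C: "\<forall>x. 0 \<le> x \<bullet> (?C *v x)"
    obtain x y where v: "v = vcat x y" using ex_vcat by blast
    show "0 \<le> v \<bullet> (?B *v v)"
      unfolding v quad using C S by (simp add: psd_def)
  qed
  ultimately show ?thesis by (simp add: psd_def)
qed

section \<open>One step of the Riccati recursion\<close>

definition lqr_gain :: "real^'n^'n \<Rightarrow> real^'m^'n \<Rightarrow> real^'m^'m \<Rightarrow> real^'n^'n \<Rightarrow> real^'n^'m" where
  "lqr_gain A B R P = - (matrix_inv (R + transpose B ** P ** B) ** (transpose B ** P ** A))"

text \<open>The Riccati map in its Joseph form, the cost of one step under the minimising gain followed by
  the cost \<open>P\<close>; this form is visibly positive semidefinite.\<close>

definition riccati_step ::
  "real^'n^'n \<Rightarrow> real^'m^'n \<Rightarrow> real^'n^'n \<Rightarrow> real^'m^'m \<Rightarrow> real^'n^'n \<Rightarrow> real^'n^'n" where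
  "riccati_step A B Q R P =
     (let K = lqr_gain A B R P; G = A + B ** K
      in Q + transpose K ** R ** K + transpose G ** P ** G)"

lemma psd_riccati_step:
  "psd Q \<Longrightarrow> psd R \<Longrightarrow> psd P \<Longrightarrow> psd (riccati_step A B Q R P)"
  by (simp add: riccati_step_def Let_def psd_add psd_congruence_transpose)

text \<open>The first-order condition for the minimising input. It makes the cross terms vanish when the
  one-step cost is expanded around that input.\<close>

lemma lqr_gain_normal_equation:
  assumes "pd R" "psd P"
  shows "R *v (lqr_gain A B R P *v x)
    + transpose B *v (P *v (A *v x + B *v (lqr_gain A B R P *v x))) = 0"
proof -
  define W where "W = R + transpose B ** P ** B"
  define K where "K = lqr_gain A B R P"
  have "invertible W"
    unfolding W_def by (intro pd_invertible pd_add_psd psd_congruence_transpose assms)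
  then have "W *v (matrix_inv W *v y) = y" for y
    by (simp add: matrix_vector_mul_assoc matrix_inv_cancel)
  moreover have "K *v x = - (matrix_inv W *v (transpose B *v (P *v (A *v x))))"
    by (simp add: K_def lqr_gain_def W_def matrix_vector_mul_assoc matrix_mul_assoc matrix_vector_mult_minus)
  ultimately have "W *v (K *v x) = - (transpose B *v (P *v (A *v x)))"
    by (simp add: linear_neg[OF matrix_vector_mul_linear])
  then show ?thesis
    by (simp add: K_def W_def matrix_vector_mult_add_rdistrib matrix_vector_right_distrib
        matrix_vector_mul_assoc[symmetric] algebra_simps add_eq_0_iff)
qed

lemma riccati_complete_square:
  assumes "pd R" "psd P"
  shows "x \<bullet> (Q *v x) + u \<bullet> (R *v u) + (A *v x + B *v u) \<bullet> (P *v (A *v x + B *v u))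
    = x \<bullet> (riccati_step A B Q R P *v x)
      + (u - lqr_gain A B R P *v x) \<bullet> ((R + transpose B ** P ** B) *v (u - lqr_gain A B R P *v x))"
proof -
  define K where "K = lqr_gain A B R P"
  define w where "w = u - K *v x"
  define y where "y = A *v x + B *v (K *v x)"
  have u: "u = K *v x + w" by (simp add: w_def)
  have y: "A *v x + B *v u = y + B *v w"
    by (simp add: u y_def matrix_vector_right_distrib)
  have sym: "transpose R = R" "transpose P = P" using assms by (auto simp: pd_def psd_def)
  have step: "x \<bullet> (riccati_step A B Q R P *v x) = x \<bullet> (Q *v x) + (K *v x) \<bullet> (R *v (K *v x)) + y \<bullet> (P *v y)"
    by (simp add: riccati_step_def Let_def K_def[symmetric] y_def matrix_vector_mult_add_rdistrib
        matrix_vector_mul_assoc[symmetric] inner_add_right inner_transpose_right)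
  have "u \<bullet> (R *v u) = (K *v x) \<bullet> (R *v (K *v x)) + 2 * (w \<bullet> (R *v (K *v x))) + w \<bullet> (R *v w)"
    using symmetric_matrix_inner[OF sym(1), of "K *v x" w]
    by (simp add: u matrix_vector_right_distrib inner_add_left inner_add_right inner_commute)
  moreover have "(y + B *v w) \<bullet> (P *v (y + B *v w))
      = y \<bullet> (P *v y) + 2 * (w \<bullet> (transpose B *v (P *v y))) + w \<bullet> ((transpose B ** P ** B) *v w)"
    using symmetric_matrix_inner[OF sym(2), of y "B *v w"]
    by (simp add: matrix_vector_right_distrib inner_add_left inner_add_right inner_commute
        inner_transpose_right matrix_vector_mul_assoc[symmetric])
  moreover have "w \<bullet> (R *v (K *v x)) + w \<bullet> (transpose B *v (P *v y)) = 0"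
    using lqr_gain_normal_equation[OF assms, where x = x and A = A and B = B]
    by (simp add: K_def y_def flip: inner_add_right)
  ultimately show ?thesis
    unfolding K_def[symmetric] w_def[symmetric] y step
    by (simp add: matrix_vector_mult_add_rdistrib inner_add_right)
qed

section \<open>Optimal feedback by completing squares\<close>

text \<open>Recursion on the remaining time \<open>N - k\<close>.\<close>

lemma backward_recursion:
  "\<exists>P. P N = z \<and> (\<forall>k<N. P k = f k (P (Suc k)))"
proof (intro exI[of _ "\<lambda>k. rec_nat z (\<lambda>j. f (N - Suc j)) (N - k)"] conjI allI impI)
  fix k assume "k < N"
  then have "N - k = Suc (N - Suc k)" "N - Suc (N - Suc k) = k" by auto
  then show "rec_nat z (\<lambda>j. f (N - Suc j)) (N - k) = f k (rec_nat z (\<lambda>j. f (N - Suc j)) (N - Suc k))"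
    by simp
qed simp

text \<open>\<open>P k\<close> is the matrix of the optimal cost from time \<open>k\<close> on.\<close>

locale lqr_riccati =
  fixes A :: "nat \<Rightarrow> real^'n^'n" and B :: "nat \<Rightarrow> real^'m^'n" and N :: nat
    and Q :: "nat \<Rightarrow> real^'n^'n" and R :: "nat \<Rightarrow> real^'m^'m" and Qf :: "real^'n^'n"
    and P :: "nat \<Rightarrow> real^'n^'n"
  assumes psd_Qf: "psd Qf"
    and psd_Q: "\<And>k. k < N \<Longrightarrow> psd (Q k)"
    and pd_R: "\<And>k. k < N \<Longrightarrow> pd (R k)"
    and P_final: "P N = Qf"
    and P_step: "\<And>k. k < N \<Longrightarrow> P k = riccati_step (A k) (B k) (Q k) (R k) (P (Suc k))"
begin

definition K :: "nat \<Rightarrow> real^'n^'m" where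
  "K k = lqr_gain (A k) (B k) (R k) (P (Suc k))"

definition W :: "nat \<Rightarrow> real^'m^'m" where
  "W k = R k + transpose (B k) ** P (Suc k) ** B k"

lemma psd_P: "k \<le> N \<Longrightarrow> psd (P k)"
proof (induction rule: inc_induct)
  case base
  then show ?case by (simp add: P_final psd_Qf)
next
  case (step k)
  then show ?case
    by (simp add: P_step psd_riccati_step psd_Q pd_R pd_imp_psd)
qed

lemma pd_W: "k < N \<Longrightarrow> pd (W k)"
  by (simp add: W_def pd_add_psd psd_congruence_transpose pd_R psd_P)

lemma complete_square:
  assumes "k < N"
  shows "x \<bullet> (Q k *v x) + u \<bullet> (R k *v u) + (A k *v x + B k *v u) \<bullet> (P (Suc k) *v (A k *v x + B k *v u))
    = x \<bullet> (P k *v x) + (u - K k *v x) \<bullet> (W k *v (u - K k *v x))"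
  using riccati_complete_square[of "R k" "P (Suc k)"] assms
  by (simp add: pd_R psd_P P_step K_def W_def)

text \<open>The squares completed at each time add up, and the optimal costs telescope. Every input thus
  pays the optimal cost plus a penalty for deviating from the feedback law.\<close>

lemma lqr_cost_eq:
  fixes x0 u
  defines "x \<equiv> ltv_state A B x0 u"
  shows "lqr_cost A B N Q R Qf x0 u
    = x0 \<bullet> (P 0 *v x0) + (\<Sum>k<N. (u k - K k *v x k) \<bullet> (W k *v (u k - K k *v x k)))"
proof -
  have "(\<Sum>k<N. x k \<bullet> (Q k *v x k) + u k \<bullet> (R k *v u k))
      = (\<Sum>k<N. (x k \<bullet> (P k *v x k) - x (Suc k) \<bullet> (P (Suc k) *v x (Suc k)))
          + (u k - K k *v x k) \<bullet> (W k *v (u k - K k *v x k)))"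
    using complete_square[of _ "x _" "u _"] by (intro sum.cong) (simp_all add: x_def algebra_simps)
  also have "\<dots> = x 0 \<bullet> (P 0 *v x 0) - x N \<bullet> (P N *v x N)
      + (\<Sum>k<N. (u k - K k *v x k) \<bullet> (W k *v (u k - K k *v x k)))"
    unfolding sum.distrib using sum_lessThan_telescope'[of "\<lambda>k. x k \<bullet> (P k *v x k)" N] by simp
  finally show ?thesis
    by (simp add: lqr_cost_def Let_def x_def[symmetric] P_final) (simp add: x_def)
qed

lemma input_error_nonneg: "k < N \<Longrightarrow> 0 \<le> w \<bullet> (W k *v w)"
  using pd_imp_psd[OF pd_W] by (simp add: psd_def)

text \<open>The closed loop pays no penalty, and since \<open>W k\<close> is positive definite no other input does
  so.\<close>

lemma lqr_optimal_gain_K: "lqr_optimal_gain A B N Q R Qf K"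
  unfolding lqr_optimal_gain_def
proof (intro allI)
  fix x0 :: "real^'n" and u :: "nat \<Rightarrow> real^'m"
  have lower: "x0 \<bullet> (P 0 *v x0) \<le> lqr_cost A B N Q R Qf x0 v" for v
    unfolding lqr_cost_eq by (auto intro!: sum_nonneg input_error_nonneg)
  \<comment> \<open>The closed loop is the system with drift \<open>A + B K\<close> and zero input.\<close>
  define z where "z = ltv_state (\<lambda>k. A k + B k ** K k) B x0 (\<lambda>_. 0)"
  have z: "ltv_state A B x0 (\<lambda>k. K k *v z k) k = z k" for k
    by (induction k)
      (simp_all add: z_def matrix_vector_mult_add_rdistrib matrix_vector_mul_assoc[symmetric])
  have attained: "lqr_cost A B N Q R Qf x0 (\<lambda>k. K k *v z k) = x0 \<bullet> (P 0 *v x0)"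
    by (simp add: lqr_cost_eq z)
  define w where "w k = u k - K k *v ltv_state A B x0 u k" for k
  have "lqr_optimal_input A B N Q R Qf x0 u
      \<longleftrightarrow> lqr_cost A B N Q R Qf x0 u \<le> x0 \<bullet> (P 0 *v x0)"
    unfolding lqr_optimal_input_def using lower attained by (metis order_trans)
  also have "\<dots> \<longleftrightarrow> (\<Sum>k<N. w k \<bullet> (W k *v w k)) \<le> 0"
    by (simp add: lqr_cost_eq w_def)
  also have "\<dots> \<longleftrightarrow> (\<Sum>k<N. w k \<bullet> (W k *v w k)) = 0"
    using sum_nonneg[of "{..<N}" "\<lambda>k. w k \<bullet> (W k *v w k)"] input_error_nonneg by force
  also have "\<dots> \<longleftrightarrow> (\<forall>k<N. w k \<bullet> (W k *v w k) = 0)"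
    by (subst sum_nonneg_eq_0_iff) (auto simp: input_error_nonneg)
  also have "\<dots> \<longleftrightarrow> (\<forall>k<N. w k = 0)"
    using pd_zero_iff[OF pd_W] by blast
  finally show "lqr_optimal_input A B N Q R Qf x0 u
      \<longleftrightarrow> (\<forall>k<N. u k = K k *v ltv_state A B x0 u k)"
    by (simp add: w_def)
qed

text \<open>The completed square, summed over the columns of a square root of \<open>S\<close>, that is for a
  state with second-moment matrix \<open>S\<close> under the feedback \<open>F\<close>.\<close>

lemma trace_complete_square:
  assumes "k < N" "psd S"
  defines "G F \<equiv> A k + B k ** F"
  shows "trace (Q k ** S) + trace (R k ** (F ** S ** transpose F))
      + trace (P (Suc k) ** (G F ** S ** transpose (G F)))
    = trace (P k ** S) + trace (W k ** ((F - K k) ** S ** transpose (F - K k)))"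
proof -
  obtain T where T: "transpose T = T" "T ** T = S"
    using psd_sqrt_exists[OF \<open>psd S\<close>] by (auto simp: psd_def)
  have col: "trace (M ** S) = (\<Sum>i\<in>UNIV. column i T \<bullet> (M *v column i T))" for M
    using trace_congruence_sqrt[OF T, of M "mat 1"] by simp
  show ?thesis
    unfolding trace_congruence_sqrt[OF T] col sum.distrib[symmetric]
    using complete_square[OF \<open>k < N\<close>, of "column _ T" "F *v column _ T"]
    by (intro sum.cong) (simp_all add: G_def matrix_vector_mult_add_rdistrib
        matrix_vector_mult_diff_rdistrib matrix_vector_mul_assoc[symmetric])
qed

end

section \<open>The value and the solutions of the semidefinite programme\<close>

text \<open>Data that satisfy the dynamics and are rich enough to represent every gain.\<close>

locale lqr_data = lqr_riccati A B N Q R Qf P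
  for A :: "nat \<Rightarrow> real^'n^'n" and B :: "nat \<Rightarrow> real^'m^'n" and N Q R Qf P +
  fixes X :: "nat \<Rightarrow> real^'l^'n" and U :: "nat \<Rightarrow> real^'l^'m"
  assumes X_Suc: "\<And>k. k < N \<Longrightarrow> X (Suc k) = A k ** X k + B k ** U k"
    and full_rank: "\<And>k. k < N \<Longrightarrow> rank (vstack (X k) (U k)) = CARD('n) + CARD('m)"
begin

text \<open>Full row rank makes the stacked data matrix surjective, so \<open>H\<close> can be chosen column by
  column.\<close>

lemma ex_H:
  assumes "k < N"
  shows "\<exists>H. X k ** H = S \<and> U k ** H = F"
proof -
  have "surj ((*v) (vstack (X k) (U k)))"
    using full_rank[OF assms] full_rank_surjective[of "vstack (X k) (U k)"] by simp
  then have "\<exists>h. vstack (X k) (U k) *v h = vcat (column j S) (column j F)" for j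
    by (metis surjD)
  then obtain h where h: "\<And>j. X k *v h j = column j S" "\<And>j. U k *v h j = column j F"
    unfolding vstack_mult_vector vcat_eq_iff by metis
  define H where "H = (\<chi> i j. h j $ i)"
  have H: "column j (Y ** H) = Y *v h j" for Y :: "real^'l^'c" and j
    by (simp add: H_def column_def matrix_matrix_mult_def matrix_vector_mult_def)
  have "X k ** H = S" "U k ** H = F"
    using H[of _ "X k"] H[of _ "U k"] h by (simp_all add: column_def vec_eq_iff)
  then show ?thesis by blast
qed

text \<open>This replaces the unknown system matrices by data: the data product is the closed-loop
  matrix applied to \<open>S\<close>.\<close>

lemma X_Suc_mult:
  assumes "k < N" "X k ** H = S" "U k ** H = F ** S"
  shows "X (Suc k) ** H = (A k + B k ** F) ** S"
  using assms(2,3) by (simp add: X_Suc[OF \<open>k < N\<close>] matrix_add_rdistrib flip: matrix_mul_assoc)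

text \<open>In terms of the gain \<open>F\<close> encoded by \<open>H\<close>, the first matrix inequality says that \<open>S'\<close>
  dominates the second moment that the closed loop driven by unit noise reaches from \<open>S\<close>, and the second that \<open>Om\<close>
  dominates the weighted second moment of its input.\<close>

lemma step_constraints_iff:
  assumes "k < N" "psd S" "transpose S' = S'" "transpose Om = Om"
    and H: "X k ** H = S" "U k ** H = F ** S"
  defines "G \<equiv> A k + B k ** F" and "V \<equiv> psd_sqrt (R k) ** F"
  shows "psd (block2 (S' - mat 1) (X (Suc k) ** H) (transpose H ** transpose (X (Suc k))) S)
      \<longleftrightarrow> psd (S' - mat 1 - G ** S ** transpose G)"
    and "psd (block2 Om (psd_sqrt (R k) ** U k ** H)
        (transpose H ** transpose (U k) ** psd_sqrt (R k)) S)
      \<longleftrightarrow> psd (Om - V ** S ** transpose V)"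
proof -
  have XH: "X (Suc k) ** H = G ** S"
    unfolding G_def by (rule X_Suc_mult[OF \<open>k < N\<close> H])
  then have "transpose H ** transpose (X (Suc k)) = transpose (G ** S)"
    by (metis matrix_transpose_mul)
  moreover have "transpose (S' - mat 1) = S' - mat 1"
    by (simp add: transpose_diff assms)
  ultimately show "psd (block2 (S' - mat 1) (X (Suc k) ** H) (transpose H ** transpose (X (Suc k))) S)
      \<longleftrightarrow> psd (S' - mat 1 - G ** S ** transpose G)"
    using psd_block2_iff_Schur[of "S' - mat 1" S G] \<open>psd S\<close> by (simp only: XH)
  have UH: "psd_sqrt (R k) ** U k ** H = V ** S"
    by (simp add: V_def H flip: matrix_mul_assoc)
  have "transpose H ** transpose (U k) ** psd_sqrt (R k) = transpose (V ** S)"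
    unfolding UH[symmetric]
    by (simp add: matrix_transpose_mul psd_sqrt_transpose[OF pd_R[OF \<open>k < N\<close>]] matrix_mul_assoc)
  then show "psd (block2 Om (psd_sqrt (R k) ** U k ** H)
        (transpose H ** transpose (U k) ** psd_sqrt (R k)) S)
      \<longleftrightarrow> psd (Om - V ** S ** transpose V)"
    using psd_block2_iff_Schur[of Om S V] assms by (simp only: UH)
qed

definition sdp_gain :: "(nat \<Rightarrow> real^'n^'n) \<Rightarrow> (nat \<Rightarrow> real^'n^'l) \<Rightarrow> nat \<Rightarrow> real^'n^'m" where
  "sdp_gain S H k = U k ** H k ** matrix_inv (S k)"

lemma feasible_step:
  assumes feas: "sdp_feasible N X U R S H Om" and "k < N" "pd (S k)"
  defines "F \<equiv> sdp_gain S H k"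
  defines "G \<equiv> A k + B k ** F" and "V \<equiv> psd_sqrt (R k) ** F"
  shows "psd (S (Suc k) - mat 1 - G ** S k ** transpose G)" "psd (Om k - V ** S k ** transpose V)"
proof -
  have H: "X k ** H k = S k" "U k ** H k = F ** S k"
    using feas \<open>k < N\<close> matrix_inv_cancel(2)[OF pd_invertible[OF \<open>pd (S k)\<close>]]
    by (simp_all add: sdp_feasible_def F_def sdp_gain_def flip: matrix_mul_assoc)
  have "transpose (S (Suc k)) = S (Suc k)" "transpose (Om k) = Om k"
    using feas \<open>k < N\<close> by (simp_all add: sdp_feasible_def)
  note schur = step_constraints_iff[OF \<open>k < N\<close> pd_imp_psd[OF \<open>pd (S k)\<close>] this H]
  have "psd (block2 (S (Suc k) - mat 1) (X (Suc k) ** H k) (transpose (H k) ** transpose (X (Suc k))) (S k))"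
    "psd (block2 (Om k) (psd_sqrt (R k) ** U k ** H k)
      (transpose (H k) ** transpose (U k) ** psd_sqrt (R k)) (S k))"
    using feas \<open>k < N\<close> unfolding sdp_feasible_def by blast+
  then show "psd (S (Suc k) - mat 1 - G ** S k ** transpose G)" "psd (Om k - V ** S k ** transpose V)"
    unfolding schur G_def V_def by simp_all
qed

text \<open>Each \<open>S k\<close> dominates the identity, at later times because the propagated second moment that is added to it
  is positive semidefinite. Hence the gain of a feasible point is well defined.\<close>

lemma feasible_pd:
  assumes feas: "sdp_feasible N X U R S H Om" and "k \<le> N"
  shows "pd (S k)"
  using \<open>k \<le> N\<close>
proof (induction k)
  case 0
  then show ?case using feas by (simp add: sdp_feasible_def pd_if_ge_mat_1)
next
  case (Suc k)
  then have k: "k < N" "pd (S k)" by simp_all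
  from psd_add[OF feasible_step(1)[OF feas k] psd_congruence[OF pd_imp_psd[OF k(2)]]]
  have "psd (S (Suc k) - mat 1)"
    by (metis diff_add_cancel)
  then show ?case by (rule pd_if_ge_mat_1)
qed

text \<open>The slack of both matrix inequalities, paired with positive semidefinite matrices, has
  nonnegative trace and can be dropped from the completed square.\<close>

lemma trace_feasible_step:
  assumes feas: "sdp_feasible N X U R S H Om" and "k < N"
  defines "D \<equiv> sdp_gain S H k - K k"
  shows "trace (P k ** S k) + trace (P (Suc k)) + trace (W k ** (D ** S k ** transpose D))
    \<le> trace (Q k ** S k) + trace (Om k) + trace (P (Suc k) ** S (Suc k))"
proof -
  define F where "F = sdp_gain S H k"
  define G where "G = A k + B k ** F"
  define V where "V = psd_sqrt (R k) ** F"
  have pd: "pd (S k)" using feasible_pd[OF feas] \<open>k < N\<close> by simp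
  note step = feasible_step[OF feas \<open>k < N\<close> pd, folded F_def, folded G_def V_def]
  have "0 \<le> trace (P (Suc k) ** (S (Suc k) - mat 1 - G ** S k ** transpose G))"
    using step(1) \<open>k < N\<close> by (intro trace_psd_mult_nonneg psd_P) auto
  then have "trace (P (Suc k)) + trace (P (Suc k) ** (G ** S k ** transpose G))
      \<le> trace (P (Suc k) ** S (Suc k))"
    by (simp add: matrix_diff_ldistrib trace_sub)
  \<comment> \<open>The factor \<open>mat 1\<close> casts nonnegativity of a trace as that of a trace of a product.\<close>
  moreover have "0 \<le> trace (mat 1 ** (Om k - V ** S k ** transpose V))"
    using step(2) by (intro trace_psd_mult_nonneg psd_mat_1)
  then have "trace (R k ** (F ** S k ** transpose F)) \<le> trace (Om k)"
    unfolding V_def by (simp add: trace_sub trace_sqrt_congruence pd_R[OF \<open>k < N\<close>])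
  moreover note trace_complete_square[OF \<open>k < N\<close> pd_imp_psd[OF pd], of F, folded G_def]
  ultimately show ?thesis by (simp add: D_def F_def[symmetric])
qed

lemma sdp_objective_telescope:
  assumes "\<And>k. k < N \<Longrightarrow> trace (Q k ** S k) + trace (Om k) + trace (P (Suc k) ** S (Suc k))
    = trace (P k ** S k) + trace (P (Suc k)) + e k"
  shows "sdp_objective N Q Qf S Om = trace (P 0 ** S 0) + (\<Sum>k<N. trace (P (Suc k))) + (\<Sum>k<N. e k)"
proof -
  have "(\<Sum>k<N. trace (Q k ** S k) + trace (Om k))
      = (\<Sum>k<N. (trace (P k ** S k) - trace (P (Suc k) ** S (Suc k))) + trace (P (Suc k)) + e k)"
    using assms by (intro sum.cong) (simp_all add: algebra_simps)
  also have "\<dots> = trace (P 0 ** S 0) - trace (P N ** S N) + (\<Sum>k<N. trace (P (Suc k))) + (\<Sum>k<N. e k)"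
    unfolding sum.distrib using sum_lessThan_telescope'[of "\<lambda>k. trace (P k ** S k)" N] by simp
  finally show ?thesis by (simp add: sdp_objective_def P_final)
qed

text \<open>With unit noise as initial state and at every later time, the optimal expected cost is the
  sum of the traces of the optimal cost matrices.\<close>

definition sdp_value :: real where
  "sdp_value = trace (P 0) + (\<Sum>k<N. trace (P (Suc k)))"

text \<open>The programme version of the completed squares: a feasible point pays at least the value plus
  a penalty for the deviation of its gain from the Riccati gain.\<close>

lemma sdp_objective_lower_bound:
  assumes feas: "sdp_feasible N X U R S H Om"
  defines "D k \<equiv> sdp_gain S H k - K k"
  shows "sdp_value + (\<Sum>k<N. trace (W k ** (D k ** S k ** transpose (D k)))) \<le> sdp_objective N Q Qf S Om"
proof -
  define e where "e k = trace (Q k ** S k) + trace (Om k) + trace (P (Suc k) ** S (Suc k))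
    - trace (P k ** S k) - trace (P (Suc k))" for k
  have "(\<Sum>k<N. trace (W k ** (D k ** S k ** transpose (D k)))) \<le> (\<Sum>k<N. e k)"
    using trace_feasible_step[OF feas] by (intro sum_mono) (simp add: e_def D_def algebra_simps)
  moreover have "0 \<le> trace (P 0 ** (S 0 - mat 1))"
    using feas by (intro trace_psd_mult_nonneg psd_P) (auto simp: sdp_feasible_def)
  then have "trace (P 0) \<le> trace (P 0 ** S 0)"
    by (simp add: matrix_diff_ldistrib trace_sub)
  moreover have "sdp_objective N Q Qf S Om
      = trace (P 0 ** S 0) + (\<Sum>k<N. trace (P (Suc k))) + (\<Sum>k<N. e k)"
    by (rule sdp_objective_telescope) (simp add: e_def)
  ultimately show ?thesis by (simp add: sdp_value_def)
qed

lemma gain_error_nonneg: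
  assumes "sdp_feasible N X U R S H Om" "k < N"
  shows "0 \<le> trace (W k ** (D ** S k ** transpose D))"
  using assms feasible_pd[OF assms(1), of k]
  by (intro trace_congruence_nonneg pd_imp_psd pd_W) auto

text \<open>Taking equality in all constraints with the Riccati gain defines \<open>S\<close> forwards in time and
  leaves no slack in any of the estimates.\<close>

lemma sdp_value_attained:
  "\<exists>S H Om. sdp_feasible N X U R S H Om \<and> sdp_objective N Q Qf S Om = sdp_value"
proof -
  define G where "G k = A k + B k ** K k" for k
  define S where "S = rec_nat (mat 1) (\<lambda>k M. mat 1 + G k ** M ** transpose (G k))"
  have S: "S 0 = mat 1" "S (Suc k) = mat 1 + G k ** S k ** transpose (G k)" for k
    by (simp_all add: S_def)
  have psd_S: "psd (S k)" for k
    by (induction k) (simp_all add: S psd_mat_1 psd_add psd_congruence)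
  define V where "V k = psd_sqrt (R k) ** K k" for k
  define Om where "Om k = V k ** S k ** transpose (V k)" for k
  have psd_Om: "psd (Om k)" for k
    by (simp add: Om_def psd_congruence psd_S)
  have "\<forall>k. \<exists>H. k < N \<longrightarrow> X k ** H = S k \<and> U k ** H = K k ** S k"
    using ex_H by blast
  then obtain H where "\<forall>k. k < N \<longrightarrow> X k ** H k = S k \<and> U k ** H k = K k ** S k"
    unfolding choice_iff by blast
  then have H: "X k ** H k = S k" "U k ** H k = K k ** S k" if "k < N" for k
    using that by blast+
  have psd_0: "psd 0" by (simp add: psd_def transpose_def vec_eq_iff)
  have sym: "transpose (S k) = S k" "transpose (Om k) = Om k" for k
    using psd_S psd_Om by (simp_all add: psd_def)
  have "sdp_feasible N X U R S H Om"
    unfolding sdp_feasible_def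
  proof (intro conjI allI impI)
    fix k assume "k < N"
    note schur = step_constraints_iff[OF \<open>k < N\<close> psd_S sym H[OF \<open>k < N\<close>], folded G_def V_def]
    show "psd (block2 (S (Suc k) - mat 1) (X (Suc k) ** H k)
        (transpose (H k) ** transpose (X (Suc k))) (S k))"
      unfolding schur by (simp add: S(2) psd_0)
    show "psd (block2 (Om k) (psd_sqrt (R k) ** U k ** H k)
        (transpose (H k) ** transpose (U k) ** psd_sqrt (R k)) (S k))"
      unfolding schur by (simp add: Om_def psd_0)
    show "S k = X k ** H k" using H(1)[OF \<open>k < N\<close>] by simp
  qed (simp_all add: sym S(1) psd_0)
  moreover have "sdp_objective N Q Qf S Om
      = trace (P 0 ** S 0) + (\<Sum>k<N. trace (P (Suc k))) + (\<Sum>k<N. 0)"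
  proof (rule sdp_objective_telescope)
    fix k assume "k < N"
    then show "trace (Q k ** S k) + trace (Om k) + trace (P (Suc k) ** S (Suc k))
        = trace (P k ** S k) + trace (P (Suc k)) + 0"
      using trace_complete_square[OF \<open>k < N\<close> psd_S[of k], where F = "K k"]
      by (simp add: S Om_def V_def G_def matrix_add_ldistrib trace_add trace_sqrt_congruence pd_R)
        (simp add: trace_def)
  qed
  ultimately show ?thesis
    by (auto simp: S sdp_value_def)
qed

lemma sdp_solution_iff:
  "sdp_solution N X U Q R Qf S H Om \<longleftrightarrow>
    sdp_feasible N X U R S H Om \<and> sdp_objective N Q Qf S Om \<le> sdp_value"
proof -
  have "sdp_value \<le> sdp_objective N Q Qf S' Om'" if "sdp_feasible N X U R S' H' Om'" for S' H' Om'
    using sdp_objective_lower_bound[OF that] gain_error_nonneg[OF that]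
      sum_nonneg[of "{..<N}" "\<lambda>k. trace (W k ** ((sdp_gain S' H' k - K k) ** S' k ** transpose (sdp_gain S' H' k - K k)))"]
    by force
  then show ?thesis
    unfolding sdp_solution_def using sdp_value_attained by (metis order_trans)
qed

text \<open>An optimal point leaves no room for a penalty. As \<open>W k\<close> and \<open>S k\<close> are positive definite,
  a zero penalty forces the gains to agree.\<close>

lemma sdp_solution_gain:
  assumes "sdp_solution N X U Q R Qf S H Om" "k < N"
  shows "sdp_gain S H k = K k"
proof -
  have feas: "sdp_feasible N X U R S H Om" and le: "sdp_objective N Q Qf S Om \<le> sdp_value"
    using assms(1) by (auto simp: sdp_solution_iff)
  define e where "e k = trace (W k ** ((sdp_gain S H k - K k) ** S k ** transpose (sdp_gain S H k - K k)))" for k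
  have nonneg: "0 \<le> e k" if "k < N" for k
    unfolding e_def using gain_error_nonneg[OF feas that] .
  have "(\<Sum>k<N. e k) \<le> 0"
    using sdp_objective_lower_bound[OF feas] le by (simp add: e_def)
  moreover have "0 \<le> (\<Sum>k<N. e k)"
    using nonneg by (intro sum_nonneg) auto
  ultimately have "(\<Sum>k<N. e k) = 0" by simp
  then have "e k = 0"
    using nonneg \<open>k < N\<close> by (subst (asm) sum_nonneg_eq_0_iff) auto
  then have "sdp_gain S H k - K k = 0"
    unfolding e_def using \<open>k < N\<close> feasible_pd[OF feas, of k]
    by (intro trace_congruence_eq_0[OF pd_W]) auto
  then show ?thesis by simp
qed

end

lemma data_matrix_Suc:
  assumes "\<And>j. xd j (Suc k) = A *v xd j k + B *v ud j k"
  shows "data_matrix xd (Suc k) = A ** data_matrix xd k + B ** data_matrix ud k"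
  by (simp add: assms data_matrix_def matrix_matrix_mult_def matrix_vector_mult_def vec_eq_iff)

theorem theorem2:
  fixes A :: "nat \<Rightarrow> real^'n^'n" and B :: "nat \<Rightarrow> real^'m^'n"
    and xd :: "'l::finite \<Rightarrow> nat \<Rightarrow> real^'n" and ud :: "'l \<Rightarrow> nat \<Rightarrow> real^'m"
    and X :: "nat \<Rightarrow> real^'l^'n" and U :: "nat \<Rightarrow> real^'l^'m"
    and Q :: "nat \<Rightarrow> real^'n^'n" and R :: "nat \<Rightarrow> real^'m^'m" and Qf :: "real^'n^'n"
    and N :: nat
  assumes data: "\<And>j k. k < N \<Longrightarrow> xd j (Suc k) = A k *v xd j k + B k *v ud j k"
    and X: "\<And>k. k \<le> N \<Longrightarrow> X k = data_matrix xd k"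
    and U: "\<And>k. k < N \<Longrightarrow> U k = data_matrix ud k"
    and rank: "\<And>k. k < N \<Longrightarrow> rank (vstack (X k) (U k)) = CARD('n) + CARD('m)"
    and Qf: "psd Qf"
    and Q: "\<And>k. k < N \<Longrightarrow> psd (Q k)"
    and R: "\<And>k. k < N \<Longrightarrow> pd (R k)"
  shows "\<exists>K. lqr_optimal_gain A B N Q R Qf K \<and>
           (\<exists>S H Om. sdp_solution N X U Q R Qf S H Om) \<and>
           (\<forall>S H Om. sdp_solution N X U Q R Qf S H Om \<longrightarrow>
              (\<forall>k<N. invertible (S k) \<and> K k = U k ** H k ** matrix_inv (S k)))"
proof -
  obtain P where P: "P N = Qf"
    "\<forall>k<N. P k = riccati_step (A k) (B k) (Q k) (R k) (P (Suc k))"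
    using backward_recursion[of N Qf "\<lambda>k. riccati_step (A k) (B k) (Q k) (R k)"] by blast
  interpret lqr_data A B N Q R Qf P X U
  proof
    show "X (Suc k) = A k ** X k + B k ** U k" if "k < N" for k
      using data_matrix_Suc[of xd k "A k" "B k" ud] data that by (simp add: X U)
  qed (use assms P in auto)
  show ?thesis
  proof (intro exI[of _ K] conjI allI impI)
    show "lqr_optimal_gain A B N Q R Qf K"
      by (rule lqr_optimal_gain_K)
    show "\<exists>S H Om. sdp_solution N X U Q R Qf S H Om"
      using sdp_value_attained by (metis sdp_solution_iff order_refl)
  next
    fix S H Om k
    assume sol: "sdp_solution N X U Q R Qf S H Om" and "k < N"
    then show "invertible (S k)"
      by (intro pd_invertible feasible_pd) (auto simp: sdp_solution_def)
    show "K k = U k ** H k ** matrix_inv (S k)"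
      using sdp_solution_gain[OF sol \<open>k < N\<close>] by (simp add: sdp_gain_def)
  qed
qed

end
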